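(* Fix an integer $n\ge 2$. The cyclic Tamari lattice $\mathsf{CTam}=\mathsf{CTam}_{312}$ and the affine Tamari lattice $\mathsf{ATam}=\mathsf{ATam}_{312}$ satisfy $$|\mathsf{CTam}|=\mathrm{Cat}_{B_n}=\binom{2n}{n}\quad\text{and}\quad|\mathsf{ATam}|=\mathrm{Cat}_{D_n}=\frac{3n-2}{n}\binom{2n-2}{n-1}.$$
   Context: Fix an integer $n\ge 2$. A translation-invariant total order (TITO) is a total order $\preceq$ on $\mathbb Z$ such that $a\preceq b$ iff $a+n\preceq b+n$ for all $a,b\in\mathbb Z$. A TITO is $312$-avoiding if there are no integers $a<b<c$ with $c\preceq a\preceq b$. A block of a TITO is a nonempty order-convex subset $I\subseteq\mathbb Z$ with no minimal or maximal element such that all intervals $[a,b]=\{x\mid a\preceq x\preceq b\}$ with $a,b\in I$ are finite; its size is the number of residue classes modulo $n$ it contains; it is waxing if $a\preceq a+n$ for $a\in I$ and waning otherwise. A TITO is real if every block of size $1$ is waxing. $\mathsf{CTam}_{312}$ is the set of $312$-avoiding TITOs and $\mathsf{ATam}_{312}$ is the set of $312$-avoiding real TITOs (each partially ordered by containment of inversion sets, though the order is irrelevant for the cardinality). *)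

theory Defs
  imports Complex_Main "HOL-Number_Theory.Cong"
begin

text \<open>A total order on the integers is a relation \<open>r\<close> with \<open>linear_order r\<close> (reflexive,
  with field \<open>UNIV\<close>); \<open>(a, b) \<in> r\<close> reads \<open>a \<preceq> b\<close>.\<close>

definition tito :: "nat \<Rightarrow> int rel \<Rightarrow> bool" where
  "tito n r \<longleftrightarrow>
     linear_order r \<and> (\<forall>a b. (a, b) \<in> r \<longleftrightarrow> (a + int n, b + int n) \<in> r)"

definition avoids_312 :: "int rel \<Rightarrow> bool" where
  "avoids_312 r \<longleftrightarrow> \<not> (\<exists>a b c. a < b \<and> b < c \<and> (c, a) \<in> r \<and> (a, b) \<in> r)"

definition order_interval :: "int rel \<Rightarrow> int \<Rightarrow> int \<Rightarrow> int set" where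
  "order_interval r a b = {x. (a, x) \<in> r \<and> (x, b) \<in> r}"

definition order_convex :: "int rel \<Rightarrow> int set \<Rightarrow> bool" where
  "order_convex r I \<longleftrightarrow> (\<forall>a\<in>I. \<forall>b\<in>I. order_interval r a b \<subseteq> I)"

definition tito_block :: "int rel \<Rightarrow> int set \<Rightarrow> bool" where
  "tito_block r I \<longleftrightarrow>
     I \<noteq> {} \<and> order_convex r I \<and>
     \<not> (\<exists>m\<in>I. \<forall>x\<in>I. (x, m) \<in> r \<longrightarrow> x = m) \<and>
     \<not> (\<exists>m\<in>I. \<forall>x\<in>I. (m, x) \<in> r \<longrightarrow> x = m) \<and>
     (\<forall>a\<in>I. \<forall>b\<in>I. finite (order_interval r a b))"

text \<open>Residue classes are counted through their representatives in \<open>{0..<n}\<close>.\<close>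

definition block_size :: "nat \<Rightarrow> int set \<Rightarrow> nat" where
  "block_size n I = card {k \<in> {0..<int n}. {x. [x = k] (mod int n)} \<subseteq> I}"

definition waxing :: "nat \<Rightarrow> int rel \<Rightarrow> int set \<Rightarrow> bool" where
  "waxing n r I \<longleftrightarrow> (\<forall>a\<in>I. (a, a + int n) \<in> r)"

definition real_tito :: "nat \<Rightarrow> int rel \<Rightarrow> bool" where
  "real_tito n r \<longleftrightarrow>
     tito n r \<and> (\<forall>I. tito_block r I \<and> block_size n I = 1 \<longrightarrow> waxing n r I)"

definition CTam :: "nat \<Rightarrow> int rel set" where
  "CTam n = {r. tito n r \<and> avoids_312 r}"

definition ATam :: "nat \<Rightarrow> int rel set" where
  "ATam n = {r. real_tito n r \<and> avoids_312 r}"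

text \<open>The Coxeter--Catalan number of a finite reflection group with Coxeter number \<open>h\<close> and
  degrees \<open>d\<^sub>1, \<dots>, d\<^sub>n\<close> is the product of the \<open>(h + d\<^sub>i) / d\<^sub>i\<close>.  Type \<open>B\<^sub>n\<close> has degrees
  \<open>2, 4, \<dots>, 2n\<close> and \<open>h = 2n\<close>; type \<open>D\<^sub>n\<close> has degrees \<open>2, 4, \<dots>, 2n - 2, n\<close> and
  \<open>h = 2n - 2\<close> (for \<open>n = 2\<close> this is \<open>A\<^sub>1 \<times> A\<^sub>1\<close>).\<close>

definition coxeter_catalan :: "nat \<Rightarrow> nat list \<Rightarrow> real" where
  "coxeter_catalan h ds = (\<Prod>d\<leftarrow>ds. real (h + d) / real d)"

definition Cat_B :: "nat \<Rightarrow> real" where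
  "Cat_B n = coxeter_catalan (2 * n) (map (\<lambda>i. 2 * i) [1..<n + 1])"

definition Cat_D :: "nat \<Rightarrow> real" where
  "Cat_D n = coxeter_catalan (2 * n - 2) (map (\<lambda>i. 2 * i) [1..<n] @ [n])"

end

theory Submission
  imports Defs
begin

text \<open>Why the numbers are \<open>2n\<close> choose \<open>n\<close> and its type \<open>D\<close> variant: \<open>312\<close>-avoiding translation-invariant
  orders are the same as periodic bracket sequences.

  In such an order the integers \<open>b > a\<close> that come before \<open>a\<close> form an initial segment of the integers above
  \<open>a\<close>. Put an opening bracket at every integer \<open>a\<close> and match it with a closing bracket at the end of
  this segment; if the segment is infinite, leave the bracket open. These brackets never cross, and a bracket
  remains open precisely when \<open>a\<close> is waning (\<open>a + n\<close> comes before \<open>a\<close>). A bracket matching is determined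
  by the numbers \<open>c j\<close> of closing brackets at each position \<open>j\<close>
  (\<open>inversion_iff_sum_closers\<close>, \<open>order_of_closers_closers\<close>). Conversely, every \<open>n\<close>-periodic sequence \<open>c\<close> of
  naturals with period sum at most \<open>n\<close> arises (\<open>tito_order_of_closers\<close>, \<open>closers_order_of_closers\<close>):
  then every closing bracket finds a partner. The elements of \<open>CTam n\<close> therefore correspond to the words of
  length \<open>n\<close> over the naturals with sum at most \<open>n\<close>, and there are \<open>2n\<close> choose \<open>n\<close> of these.

  The period sum counts the waxing residue classes, so the number of waning ones is \<open>n\<close> minus the sum
  (\<open>sum_closers_waning_count\<close>). Waning elements are all in reversed order and no waxing element lies between
  them, so they form a single block, and the order is real unless there is exactly one waning class
  (\<open>real_iff_waning_count\<close>). The orders that fail to be real thus correspond to the words of length \<open>n\<close>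
  with sum \<open>n - 1\<close>; their number, \<open>2n - 2\<close> choose \<open>n - 1\<close>, is the difference of the two Catalan
  numbers.\<close>

section \<open>Noncrossing brackets of an avoiding order\<close>

text \<open>An inversion of a \<open>312\<close>-avoiding order \<open>r\<close> is a pair \<open>a < b\<close> with \<open>b\<close> before \<open>a\<close>. For fixed \<open>a\<close>
  the avoidance makes the \<open>b\<close> with this property an initial segment of the integers above \<open>a\<close>; \<open>j\<close> closes
  \<open>a\<close> if the segment ends at \<open>j\<close> (so \<open>j = a\<close> if \<open>a\<close> has no inversions). In the picture of matched
  brackets, an opening bracket stands at \<open>a\<close> and its partner at \<open>j\<close>.\<close>
definition closes :: "int rel \<Rightarrow> int \<Rightarrow> int \<Rightarrow> bool" where
  "closes r a j \<longleftrightarrow> a \<le> j \<and> (j, a) \<in> r \<and> (a, j + 1) \<in> r"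

definition closers :: "int rel \<Rightarrow> int \<Rightarrow> nat" where
  "closers r j = card {a. closes r a j}"

locale tamari_order =
  fixes n :: nat and r :: "int rel"
  assumes n_pos: "n > 0"
    and tito: "tito n r"
    and avoids: "avoids_312 r"
begin

abbreviation le (infix "\<preceq>" 50) where "a \<preceq> b \<equiv> (a, b) \<in> r"

lemma tito_refl: "a \<preceq> a"
  using tito unfolding tito_def linear_order_on_def partial_order_on_def preorder_on_def
  by (auto dest: refl_onD)

lemma tito_trans: "a \<preceq> b \<Longrightarrow> b \<preceq> c \<Longrightarrow> a \<preceq> c"
  using tito unfolding tito_def linear_order_on_def partial_order_on_def preorder_on_def
  by (auto dest: transD)

lemma tito_antisym: "a \<preceq> b \<Longrightarrow> b \<preceq> a \<Longrightarrow> a = b"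
  using tito unfolding tito_def linear_order_on_def partial_order_on_def
  by (auto dest: antisymD)

lemma tito_total: "a \<preceq> b \<or> b \<preceq> a"
proof (cases "a = b")
  case False
  have "total_on UNIV r" using tito by (simp add: tito_def linear_order_on_def)
  then show ?thesis using False by (simp add: total_on_def)
qed (simp add: tito_refl)

lemma shift: "a + int n \<preceq> b + int n \<longleftrightarrow> a \<preceq> b"
  using tito unfolding tito_def by blast

lemma shift_mult: "a + k * int n \<preceq> b + k * int n \<longleftrightarrow> a \<preceq> b"
proof (induction k rule: int_induct[of _ 0])
  case (step1 i)
  then show ?case
    using shift[of "a + i * int n" "b + i * int n"] by (simp add: algebra_simps)
next
  case (step2 i)
  then show ?case
    using shift[of "a + (i - 1) * int n" "b + (i - 1) * int n"] by (simp add: algebra_simps)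
qed simp

text \<open>This is the form in which \<open>312\<close>-avoidance is used everywhere: inversions with a fixed smaller
  element \<open>a\<close> form an initial segment.\<close>
lemma inversion_prefix:
  assumes "c \<preceq> a" "a \<le> b" "b \<le> c" shows "b \<preceq> a"
proof (cases "a = b \<or> b = c")
  case False
  then have "a < b" "b < c" using assms by auto
  then have "\<not> a \<preceq> b"
    using assms(1) avoids unfolding avoids_312_def by blast
  then show ?thesis using tito_total by blast
next
  case True
  then show ?thesis using assms(1) tito_refl by metis
qed

text \<open>Waning is a property of the residue class, so it is stated pointwise and without reference to blocks.\<close>
definition waning_at :: "int \<Rightarrow> bool" where
  "waning_at a \<longleftrightarrow> a + int n \<preceq> a"

lemma waning_at_shift: "waning_at (a + k * int n) \<longleftrightarrow> waning_at a"
  using shift_mult[of "a + int n" k a] by (simp add: waning_at_def algebra_simps)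

lemma waning_at_mod: "waning_at (a mod int n) \<longleftrightarrow> waning_at a"
  using waning_at_shift[of "a mod int n" "a div int n"] by simp

lemma waning_multiple:
  assumes "waning_at a" shows "a + int k * int n \<preceq> a"
proof (induction k)
  case (Suc k)
  have "a + int (Suc k) * int n \<preceq> a + int n"
    using Suc shift[of "a + int k * int n" a] by (simp add: algebra_simps)
  then show ?case using assms tito_trans unfolding waning_at_def by blast
qed (simp add: tito_refl)

lemma waxing_multiple:
  assumes "\<not> waning_at a" shows "a \<preceq> a + int k * int n"
proof (induction k)
  case (Suc k)
  have "a + int n \<preceq> a + int (Suc k) * int n"
    using Suc shift[of a "a + int k * int n"] by (simp add: algebra_simps)
  then show ?case using assms tito_total tito_trans unfolding waning_at_def by blast
qed (simp add: tito_refl)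

text \<open>Iterating \<open>a + n \<preceq> a\<close> inverts \<open>a\<close> with arbitrarily large integers, hence with all larger ones. So
  waning elements are those whose inversion segment is infinite, and any two of them stand in reversed
  order.\<close>
lemma larger_below_waning:
  assumes "waning_at a" "a \<le> b" shows "b \<preceq> a"
proof (rule inversion_prefix[OF waning_multiple[OF assms(1), of "nat (b - a)"] assms(2)])
  have "(b - a) * 1 \<le> (b - a) * int n"
    using assms n_pos by (intro mult_left_mono) auto
  then show "b \<le> a + int (nat (b - a)) * int n" using assms(2) by simp
qed

lemma closes_unique:
  assumes "closes r a i" "closes r a j" shows "i = j"
proof -
  have False if "closes r a i" "closes r a j" "i < j" for i j
  proof -
    have "i + 1 \<preceq> a"
      using that inversion_prefix[of j a "i + 1"] by (auto simp: closes_def)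
    then have "a = i + 1" using that tito_antisym by (auto simp: closes_def)
    then show False using that by (simp add: closes_def)
  qed
  then show ?thesis using assms by (metis linorder_neqE)
qed

text \<open>The closing position is the last element of the inversion segment.\<close>
lemma closes_exists:
  assumes "a < b" "a \<preceq> b" shows "\<exists>j<b. closes r a j"
proof -
  define J where "J = {j \<in> {a..b}. j \<preceq> a}"
  have "finite J" unfolding J_def by (rule finite_subset[of _ "{a..b}"]) auto
  then have J: "finite J" "a \<in> J" using assms tito_refl by (auto simp: J_def)
  have j: "Max J \<in> J" using J Max_in by blast
  have "\<not> b \<preceq> a" using assms tito_antisym[of a b] by auto
  then have "b \<notin> J" by (simp add: J_def)
  then have "Max J \<noteq> b" using j by metis
  then have lt: "Max J < b" using j by (simp add: J_def)
  have "Max J + 1 \<notin> J" using Max_ge[OF J(1), of "Max J + 1"] by linarith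
  then have "a \<preceq> Max J + 1" using lt j tito_total[of a "Max J + 1"] by (auto simp: J_def)
  then show ?thesis using j lt by (auto simp: J_def closes_def)
qed

lemma not_closed_before:
  assumes "b \<preceq> a" "i < b" shows "\<not> closes r a i"
proof
  assume c: "closes r a i"
  then have "i + 1 \<preceq> a" using inversion_prefix[OF assms(1), of "i + 1"] assms(2)
    by (simp add: closes_def)
  then show False using c tito_antisym[of a "i + 1"] by (simp add: closes_def)
qed

text \<open>The intervals from an element to its closing position are nested or disjoint, as for matched
  brackets. Otherwise \<open>j + 1 \<preceq> b \<preceq> a\<close> would invert \<open>a\<close> beyond its closing position \<open>j\<close>.\<close>
lemma closes_nested:
  assumes "closes r a j" "a \<le> b" "b \<le> j" shows "\<exists>i\<le>j. closes r b i"
proof -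
  have "b \<preceq> a" using assms inversion_prefix by (auto simp: closes_def)
  moreover have "\<not> j + 1 \<preceq> a"
    using assms tito_antisym[of a "j + 1"] by (auto simp: closes_def)
  ultimately have "b \<preceq> j + 1" using tito_trans tito_total by blast
  then have "\<exists>i<j + 1. closes r b i" using closes_exists[of b "j + 1"] assms(3) by simp
  then show ?thesis by (metis zless_add1_eq order_le_less)
qed

text \<open>A waxing element is not inverted with its own translate, so its segment is finite.\<close>
lemma closes_iff_waxing: "(\<exists>j. closes r a j) \<longleftrightarrow> \<not> waning_at a"
proof
  assume "\<exists>j. closes r a j"
  then obtain j where j: "closes r a j" by blast
  show "\<not> waning_at a"
  proof
    assume "waning_at a"
    then have "j + 1 \<preceq> a"
      using j larger_below_waning[of a "j + 1"] by (simp add: closes_def)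
    then show False using j not_closed_before[of "j + 1" a j] by simp
  qed
next
  assume "\<not> waning_at a"
  then show "\<exists>j. closes r a j"
    using closes_exists[of a "a + int n"] n_pos tito_total by (auto simp: waning_at_def)
qed

lemma closes_near:
  assumes "closes r a j" shows "j < a + int n"
proof (rule ccontr)
  assume "\<not> j < a + int n"
  then have "a + int n \<preceq> a"
    using assms inversion_prefix[of j a "a + int n"] by (simp add: closes_def)
  then show False using assms closes_iff_waxing by (auto simp: waning_at_def)
qed

lemma finite_closes: "finite {a. closes r a j}"
proof (rule finite_subset)
  show "{a. closes r a j} \<subseteq> {j - int n..j}"
    using closes_near by (force simp: closes_def)
qed simp

lemma closes_shift: "closes r (a + k * int n) (j + k * int n) \<longleftrightarrow> closes r a j"
  using shift_mult[of j k a] shift_mult[of a k "j + 1"] by (simp add: closes_def algebra_simps)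

lemma closers_periodic: "closers r (j + int n) = closers r j"
proof -
  have "{a. closes r a (j + int n)} = (\<lambda>a. a + int n) ` {a. closes r a j}"
    using closes_shift[of _ 1 j] by (force simp: image_iff intro: exI[of _ "_ - int n"])
  then show ?thesis by (simp add: closers_def card_image)
qed

lemma finite_closed_within: "finite {x. \<exists>i\<in>{a..<b}. closes r x i}"
proof -
  have "{x. \<exists>i\<in>{a..<b}. closes r x i} = (\<Union>i\<in>{a..<b}. {x. closes r x i})" by auto
  then show ?thesis using finite_closes by simp
qed

lemma sum_closers:
  "(\<Sum>i\<in>{a..<b}. closers r i) = card {x. \<exists>i\<in>{a..<b}. closes r x i}"
proof -
  have "(\<Sum>i\<in>{a..<b}. closers r i) = card (\<Union>i\<in>{a..<b}. {x. closes r x i})"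
    unfolding closers_def
    by (rule card_UN_disjoint[symmetric]) (auto simp: finite_closes dest: closes_unique)
  also have "(\<Union>i\<in>{a..<b}. {x. closes r x i}) = {x. \<exists>i\<in>{a..<b}. closes r x i}" by auto
  finally show ?thesis .
qed

text \<open>Bracket matching: the bracket opened at \<open>a\<close> is still open at \<open>b\<close> iff no initial part of
  \<open>[a, b)\<close> has as many closing as opening brackets. This recovers the order from the numbers of closing
  brackets.\<close>
lemma inversion_iff_sum_closers:
  assumes "a < b"
  shows "b \<preceq> a \<longleftrightarrow> (\<forall>j\<in>{a<..b}. int (\<Sum>i\<in>{a..<j}. closers r i) < j - a)"
proof
  assume ba: "b \<preceq> a"
  show "\<forall>j\<in>{a<..b}. int (\<Sum>i\<in>{a..<j}. closers r i) < j - a"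
  proof
    fix j assume j: "j \<in> {a<..b}"
    \<comment> \<open>As \<open>a\<close> is still open at \<open>j\<close>, by nesting only brackets opened strictly after \<open>a\<close> are closed before \<open>j\<close>.\<close>
    have "{x. \<exists>i\<in>{a..<j}. closes r x i} \<subseteq> {a<..<j}"
    proof clarify
      fix x i assume i: "i \<in> {a..<j}" "closes r x i"
      have "\<not> x \<le> a"
      proof
        assume "x \<le> a"
        then obtain i' where "i' \<le> i" "closes r a i'" using i closes_nested[of x i a] by auto
        then show False using not_closed_before[OF ba, of i'] i j by auto
      qed
      then show "x \<in> {a<..<j}" using i by (auto simp: closes_def)
    qed
    then have "card {x. \<exists>i\<in>{a..<j}. closes r x i} \<le> card {a<..<j}" by (intro card_mono) auto
    then show "int (\<Sum>i\<in>{a..<j}. closers r i) < j - a"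
      using j unfolding sum_closers by simp linarith
  qed
next
  assume small: "\<forall>j\<in>{a<..b}. int (\<Sum>i\<in>{a..<j}. closers r i) < j - a"
  show "b \<preceq> a"
  proof (rule ccontr)
    assume "\<not> b \<preceq> a"
    then obtain j where j: "j < b" "closes r a j" using closes_exists assms tito_total by blast
    \<comment> \<open>If \<open>j\<close> closes \<open>a\<close>, every bracket opened in \<open>[a, j]\<close> is closed there too, by nesting.\<close>
    have "{a..<j + 1} \<subseteq> {x. \<exists>i\<in>{a..<j + 1}. closes r x i}"
    proof
      fix x assume x: "x \<in> {a..<j + 1}"
      then obtain i where "i \<le> j" "closes r x i" using j closes_nested[of a j x] by auto
      then show "x \<in> {x. \<exists>i\<in>{a..<j + 1}. closes r x i}" using x by (auto simp: closes_def)
    qed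
    then have "card {a..<j + 1} \<le> card {x. \<exists>i\<in>{a..<j + 1}. closes r x i}"
      by (intro card_mono finite_closed_within)
    moreover have "a \<le> j" using j by (simp add: closes_def)
    ultimately show False using small[rule_format, of "j + 1"] j by (simp add: sum_closers)
  qed
qed

text \<open>Sending a closed element to its residue is a bijection from the brackets closed within one period
  onto the waxing residues: exactly one translate of a waxing element has its closing position in
  \<open>[0, n)\<close>.\<close>
lemma sum_closers_period:
  "(\<Sum>i\<in>{0..<int n}. closers r i) = card {a \<in> {0..<int n}. \<not> waning_at a}"
proof -
  let ?X = "{x. \<exists>i\<in>{0..<int n}. closes r x i}"
  have "inj_on (\<lambda>x. x mod int n) ?X"
  proof (rule inj_onI, clarify)
    fix x y i j
    assume xy: "x mod int n = y mod int n"
      and i: "i \<in> {0..<int n}" "closes r x i" and j: "j \<in> {0..<int n}" "closes r y j"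
    obtain k where k: "y = x + k * int n"
      using xy by (metis add.commute mod_eqE mult.commute)
    then have "j = i + k * int n" using i(2) j(2) closes_shift[of x k i] closes_unique by blast
    then have "j mod int n = i mod int n" by simp
    then have "j = i" using i j by simp
    then show "x = y" using k \<open>j = i + k * int n\<close> by simp
  qed
  moreover have "(\<lambda>x. x mod int n) ` ?X = {a \<in> {0..<int n}. \<not> waning_at a}"
  proof (intro equalityI subsetI)
    fix a assume "a \<in> (\<lambda>x. x mod int n) ` ?X"
    then show "a \<in> {a \<in> {0..<int n}. \<not> waning_at a}"
      using n_pos waning_at_mod closes_iff_waxing by auto
  next
    fix a assume a: "a \<in> {a \<in> {0..<int n}. \<not> waning_at a}"
    then obtain j where j: "closes r a j" using closes_iff_waxing by blast
    let ?k = "- (j div int n)"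
    have "closes r (a + ?k * int n) (j + ?k * int n)" using j closes_shift by blast
    moreover have "j + ?k * int n = j mod int n" by (simp add: minus_div_mult_eq_mod)
    moreover have "(a + ?k * int n) mod int n = a" using a by (metis (no_types, lifting) atLeastLessThan_iff mem_Collect_eq mod_mult_self1 mod_pos_pos_trivial)
    ultimately show "a \<in> (\<lambda>x. x mod int n) ` ?X"
      using n_pos by (intro image_eqI[of _ _ "a + ?k * int n"]) auto
  qed
  ultimately have "card {a \<in> {0..<int n}. \<not> waning_at a} = card ?X"
    by (metis (lifting) card_image)
  then show ?thesis unfolding sum_closers by (rule sym)
qed

definition waning_count :: nat where
  "waning_count = card {a \<in> {0..<int n}. waning_at a}"

lemma sum_closers_waning_count: "(\<Sum>i\<in>{0..<int n}. closers r i) + waning_count = n"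
proof -
  have "card {a \<in> {0..<int n}. \<not> waning_at a} + card {a \<in> {0..<int n}. waning_at a}
        = card ({a \<in> {0..<int n}. \<not> waning_at a} \<union> {a \<in> {0..<int n}. waning_at a})"
    by (rule card_Un_disjoint[symmetric])
      (auto intro: finite_subset[of _ "{0..<int n}"])
  also have "{a \<in> {0..<int n}. \<not> waning_at a} \<union> {a \<in> {0..<int n}. waning_at a} = {0..<int n}"
    by auto
  finally show ?thesis by (simp add: sum_closers_period waning_count_def)
qed

section \<open>The waning block\<close>
text \<open>Waning elements are convex in the order: if \<open>x\<close> were waxing and above \<open>a\<close>, it would be above all
  translates of \<open>a\<close>, including those that are numerically small and hence lie above \<open>b\<close>.\<close>
lemma between_waning:
  assumes "waning_at a" "waning_at b" "a \<preceq> x" "x \<preceq> b"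
  shows "waning_at x"
proof (rule ccontr)
  assume x: "\<not> waning_at x"
  \<comment> \<open>A translate of \<open>a\<close> smaller than \<open>b\<close> lies above \<open>b\<close> in the order.\<close>
  obtain k :: nat where k: "a - int k * int n < b"
  proof
    have "int (nat (a - b + 1)) * 1 \<le> int (nat (a - b + 1)) * int n"
      using n_pos by (intro mult_left_mono) auto
    then show "a - int (nat (a - b + 1)) * int n < b" by linarith
  qed
  have "a + - int k * int n \<preceq> x + - int k * int n" using assms(3) shift_mult by blast
  moreover have "\<not> waning_at (x + - int k * int n)" using x waning_at_shift by blast
  from waxing_multiple[OF this, of k] have "x + - int k * int n \<preceq> x" by simp
  ultimately have "a - int k * int n \<preceq> x" using tito_trans by simp
  moreover have w: "waning_at (a - int k * int n)"
    using assms(1) waning_at_shift[of a "- int k"] by simp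
  then have "b \<preceq> a - int k * int n" using k larger_below_waning by simp
  ultimately have "x = a - int k * int n" using assms(4) tito_trans tito_antisym by blast
  then show False using w x by simp
qed

lemma interval_waning:
  assumes "waning_at a" "waning_at b"
  shows "order_interval r a b \<subseteq> {x \<in> {b..a}. waning_at x}"
proof
  fix x assume x: "x \<in> order_interval r a b"
  then have ax: "a \<preceq> x" and xb: "x \<preceq> b" by (simp_all add: order_interval_def)
  then have w: "waning_at x" using assms between_waning by blast
  have "b \<le> x"
  proof (rule ccontr)
    assume "\<not> b \<le> x"
    then have "b \<preceq> x" "b \<noteq> x" using larger_below_waning[OF w, of b] by auto
    then show False using xb tito_antisym by blast
  qed
  moreover have "x \<le> a"
  proof (rule ccontr)
    assume "\<not> x \<le> a"
    then have "x \<preceq> a" "x \<noteq> a" using larger_below_waning[OF assms(1), of x] by auto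
    then show False using ax tito_antisym by blast
  qed
  ultimately show "x \<in> {x \<in> {b..a}. waning_at x}" using w by simp
qed


text \<open>A single waning class is convex by the preceding lemma, and ordered like the reversed integers.\<close>
lemma waning_class_block:
  assumes "{x \<in> {0..<int n}. waning_at x} = {a}"
  shows "tito_block r {x. [x = a] (mod int n)}"
    "block_size n {x. [x = a] (mod int n)} = 1"
    "\<not> waxing n r {x. [x = a] (mod int n)}"
proof -
  let ?I = "{x. [x = a] (mod int n)}"
  have a: "a \<in> {0..<int n}" "waning_at a" using assms by auto
  have I: "?I = {x. waning_at x}"
  proof (intro set_eqI)
    fix x
    have "waning_at x \<longleftrightarrow> x mod int n \<in> {x \<in> {0..<int n}. waning_at x}"
      using waning_at_mod n_pos by auto
    also have "\<dots> \<longleftrightarrow> x mod int n = a mod int n" using assms a by simp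
    finally show "x \<in> ?I \<longleftrightarrow> x \<in> {x. waning_at x}" by (simp add: cong_def)
  qed
  have step: "x + int n \<in> ?I" "x - int n \<in> ?I" "x + int n \<preceq> x" "x \<preceq> x - int n"
    if "x \<in> ?I" for x
    using that waning_at_shift[of x 1] waning_at_shift[of x "- 1"] shift[of x "x - int n"]
    unfolding I by (auto simp: waning_at_def)
  show "tito_block r ?I" unfolding tito_block_def
  proof (intro conjI)
    show "?I \<noteq> {}" using a I by auto
    show "order_convex r ?I" unfolding order_convex_def I
    proof (intro ballI)
      fix x y assume "x \<in> {x. waning_at x}" "y \<in> {x. waning_at x}"
      then show "order_interval r x y \<subseteq> {x. waning_at x}" using interval_waning[of x y] by auto
    qed
    show "\<not> (\<exists>m\<in>?I. \<forall>x\<in>?I. x \<preceq> m \<longrightarrow> x = m)"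
    proof
      assume "\<exists>m\<in>?I. \<forall>x\<in>?I. x \<preceq> m \<longrightarrow> x = m"
      then obtain m where "m \<in> ?I" "\<forall>x\<in>?I. x \<preceq> m \<longrightarrow> x = m" by blast
      then have "m + int n = m" using step[of m] by blast
      then show False using n_pos by simp
    qed
    show "\<not> (\<exists>m\<in>?I. \<forall>x\<in>?I. m \<preceq> x \<longrightarrow> x = m)"
    proof
      assume "\<exists>m\<in>?I. \<forall>x\<in>?I. m \<preceq> x \<longrightarrow> x = m"
      then obtain m where "m \<in> ?I" "\<forall>x\<in>?I. m \<preceq> x \<longrightarrow> x = m" by blast
      then have "m - int n = m" using step[of m] by blast
      then show False using n_pos by simp
    qed
    show "\<forall>a\<in>?I. \<forall>b\<in>?I. finite (order_interval r a b)"
      unfolding I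
    proof (intro ballI)
      fix x y assume "x \<in> {x. waning_at x}" "y \<in> {x. waning_at x}"
      then have "order_interval r x y \<subseteq> {y..x}" using interval_waning[of x y] by auto
      then show "finite (order_interval r x y)" by (rule finite_subset) simp
    qed
  qed
  have "{k \<in> {0..<int n}. {x. [x = k] (mod int n)} \<subseteq> ?I} = {a}"
  proof -
    have "k = a" if "k \<in> {0..<int n}" "[k = a] (mod int n)" for k
      using that a cong_less_imp_eq_int by auto
    moreover have "[x = x] (mod int n)" for x by (rule cong_refl)
    ultimately show ?thesis using a by blast
  qed
  then show "block_size n ?I = 1" by (simp add: block_size_def)
  show "\<not> waxing n r ?I"
  proof
    assume "waxing n r ?I"
    then have "a \<preceq> a + int n" using a I by (auto simp: waxing_def)
    then show False using a n_pos tito_antisym[of a "a + int n"] by (simp add: waning_at_def)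
  qed
qed

text \<open>A block that contains one waning element contains them all. In one direction: if a waning \<open>y\<close>
  were below the whole block, the part of the block below \<open>a\<close> would lie in the finite interval from \<open>y\<close>
  to \<open>a\<close>, and the block would have a minimum. All elements of that part are waning, so its minimum in
  the order is its numerical maximum.\<close>
lemma block_reaches_below:
  assumes "tito_block r I" "a \<in> I" "waning_at a" "waning_at y"
  shows "\<exists>u\<in>I. u \<preceq> y"
proof (rule ccontr)
  assume no: "\<not> (\<exists>u\<in>I. u \<preceq> y)"
  define L where "L = {x \<in> I. x \<preceq> a}"
  have "L \<subseteq> order_interval r y a" 
    using no tito_total unfolding L_def order_interval_def by blast
  then have sub: "L \<subseteq> {x \<in> {a..y}. waning_at x}"
    using interval_waning[OF assms(4,3)] by blast
  then have "L \<subseteq> {a..y}" by auto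
  then have "finite L" by (rule finite_subset) simp
  moreover have "a \<in> L" using assms tito_refl by (simp add: L_def)
  ultimately have m: "Max L \<in> L" "\<And>x. x \<in> L \<Longrightarrow> x \<le> Max L"
    using Max_in[of L] Max_ge[of L] by blast+
  have "x = Max L" if "x \<in> I" "x \<preceq> Max L" for x
  proof -
    have "x \<in> L" using that m(1) tito_trans[of x "Max L" a] by (simp add: L_def)
    then have "waning_at x" "x \<le> Max L" using m sub by auto
    then have "Max L \<preceq> x" by (rule larger_below_waning)
    with that(2) show ?thesis by (rule tito_antisym)
  qed
  moreover have "Max L \<in> I" using m(1) by (simp add: L_def)
  ultimately show False using assms(1) unfolding tito_block_def by blast
qed

lemma block_reaches_above:
  assumes "tito_block r I" "a \<in> I" "waning_at a" "waning_at y"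
  shows "\<exists>v\<in>I. y \<preceq> v"
proof (rule ccontr)
  assume no: "\<not> (\<exists>v\<in>I. y \<preceq> v)"
  define U where "U = {x \<in> I. a \<preceq> x}"
  have "U \<subseteq> order_interval r a y" 
    using no tito_total unfolding U_def order_interval_def by blast
  then have sub: "U \<subseteq> {x \<in> {y..a}. waning_at x}"
    using interval_waning[OF assms(3,4)] by blast
  then have "U \<subseteq> {y..a}" by auto
  then have "finite U" by (rule finite_subset) simp
  moreover have "a \<in> U" using assms tito_refl by (simp add: U_def)
  ultimately have m: "Min U \<in> U" "\<And>x. x \<in> U \<Longrightarrow> Min U \<le> x"
    using Min_in[of U] Min_le[of U] by blast+
  have "x = Min U" if "x \<in> I" "Min U \<preceq> x" for x
  proof -
    have "x \<in> U" using that m(1) tito_trans[of a "Min U" x] by (simp add: U_def)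
    then have "waning_at (Min U)" "Min U \<le> x" using m sub by auto
    then have "x \<preceq> Min U" by (rule larger_below_waning)
    then show ?thesis using that(2) by (rule tito_antisym)
  qed
  moreover have "Min U \<in> I" using m(1) by (simp add: U_def)
  ultimately show False using assms(1) unfolding tito_block_def by blast
qed

lemma waning_in_block:
  assumes "tito_block r I" "a \<in> I" "waning_at a" "waning_at y"
  shows "y \<in> I"
proof -
  obtain u v where "u \<in> I" "u \<preceq> y" "v \<in> I" "y \<preceq> v"
    using block_reaches_below[OF assms] block_reaches_above[OF assms] by blast
  then show ?thesis
    using assms(1) unfolding tito_block_def order_convex_def order_interval_def by blast
qed

text \<open>The waning elements, if any, form one block, whose size is the number of waning residues. This is
  the only block that can violate the reality condition.\<close>
lemma real_iff_waning_count: "real_tito n r \<longleftrightarrow> waning_count \<noteq> 1"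
proof
  assume real: "real_tito n r"
  show "waning_count \<noteq> 1"
  proof
    assume "waning_count = 1"
    then obtain a where a: "{x \<in> {0..<int n}. waning_at x} = {a}"
      unfolding waning_count_def by (rule card_1_singletonE)
    show False using real waning_class_block[OF a] unfolding real_tito_def by blast
  qed
next
  assume count: "waning_count \<noteq> 1"
  have "waxing n r I" if I: "tito_block r I" "block_size n I = 1" for I
  proof (rule ccontr)
    assume "\<not> waxing n r I"
    then obtain a where a: "a \<in> I" "waning_at a"
      using tito_total unfolding waxing_def waning_at_def by blast
    let ?W = "{k \<in> {0..<int n}. waning_at k}"
    have "?W \<subseteq> {k \<in> {0..<int n}. {x. [x = k] (mod int n)} \<subseteq> I}"
    proof clarify
      fix k x assume "k \<in> {0..<int n}" "waning_at k" "[x = k] (mod int n)"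
      then have "waning_at x" using waning_at_mod by (metis cong_def)
      then show "x \<in> I" using waning_in_block[OF I(1) a] by blast
    qed
    moreover have "finite {k \<in> {0..<int n}. {x. [x = k] (mod int n)} \<subseteq> I}"
      by (rule finite_subset[of _ "{0..<int n}"]) auto
    ultimately have "waning_count \<le> block_size n I"
      unfolding waning_count_def block_size_def by (rule card_mono[rotated])
    moreover have "a mod int n \<in> ?W" using a n_pos waning_at_mod by simp
    moreover have "finite ?W" by (rule finite_subset[of _ "{0..<int n}"]) auto
    ultimately have "waning_count \<noteq> 0" unfolding waning_count_def by auto
    with \<open>waning_count \<le> block_size n I\<close> show False using count I by simp
  qed
  then show "real_tito n r" using tito unfolding real_tito_def by blast
qed

end

section \<open>The order determined by a sequence of closing brackets\<close>
text \<open>The lattice path with increments \<open>c j - 1\<close>, for the bracket opened at \<open>j\<close> and the \<open>c j\<close> brackets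
  closed there; the second sum extends it to negative arguments so that the height at \<open>0\<close> is \<open>0\<close>.\<close>
definition height :: "(int \<Rightarrow> nat) \<Rightarrow> int \<Rightarrow> int" where
  "height c j = (\<Sum>i\<in>{0..<j}. int (c i) - 1) - (\<Sum>i\<in>{j..<0}. int (c i) - 1)"

lemma height_step: "height c (j + 1) = height c j + int (c j) - 1"
proof (cases "j \<ge> 0")
  case True
  then have "{0..<j + 1} = insert j {0..<j}" by auto
  then show ?thesis using True by (simp add: height_def)
next
  case False
  then have "{j..<0} = insert j {j + 1..<0}" by auto
  then show ?thesis using False by (simp add: height_def)
qed

lemma height_0 [simp]: "height c 0 = 0"
  by (simp add: height_def)

lemma height_diff:
  assumes "a \<le> b"
  shows "int (\<Sum>i\<in>{a..<b}. c i) = height c b - height c a + (b - a)"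
  using assms
proof (induction b rule: int_ge_induct)
  case (step b)
  then have "{a..<b + 1} = insert b {a..<b}" by auto
  then show ?case using step by (simp add: height_step)
qed simp

text \<open>In terms of heights: the bracket opened at \<open>a\<close> is still open at \<open>b\<close> iff the path has stayed below
  its level at \<open>a\<close> since then.\<close>
definition dominates :: "(int \<Rightarrow> nat) \<Rightarrow> int \<Rightarrow> int \<Rightarrow> bool" where
  "dominates c a b \<longleftrightarrow> a < b \<and> (\<forall>j\<in>{a<..b}. height c j < height c a)"

definition order_of_closers :: "(int \<Rightarrow> nat) \<Rightarrow> int rel" where
  "order_of_closers c = {(x, y). x = y \<or> (x < y \<and> \<not> dominates c x y) \<or> dominates c y x}"

context tamari_order
begin

lemma inversion_iff_dominates:
  assumes "a < b" shows "b \<preceq> a \<longleftrightarrow> dominates (closers r) a b"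
proof -
  have "int (\<Sum>i\<in>{a..<j}. closers r i) < j - a
        \<longleftrightarrow> height (closers r) j < height (closers r) a" if "j \<in> {a<..b}" for j
    using that height_diff[of a j "closers r"] by simp
  then show ?thesis
    using inversion_iff_sum_closers[OF assms] assms unfolding dominates_def by blast
qed

lemma order_of_closers_closers: "order_of_closers (closers r) = r"
proof -
  have "(x, y) \<in> order_of_closers (closers r) \<longleftrightarrow> x \<preceq> y" for x y
  proof (cases x y rule: linorder_cases)
    case less
    then have "x \<preceq> y \<longleftrightarrow> \<not> y \<preceq> x" using tito_total tito_antisym by blast
    then show ?thesis using less inversion_iff_dominates[OF less]
      by (simp add: order_of_closers_def dominates_def)
  next
    case equal
    then show ?thesis by (simp add: tito_refl order_of_closers_def)
  next
    case greater
    then show ?thesis using inversion_iff_dominates[OF greater]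
      by (simp add: order_of_closers_def)
  qed
  then show ?thesis by auto
qed

end

lemma order_of_closers_less:
  "a < b \<Longrightarrow> (b, a) \<in> order_of_closers c \<longleftrightarrow> dominates c a b"
  "a < b \<Longrightarrow> (a, b) \<in> order_of_closers c \<longleftrightarrow> \<not> dominates c a b"
  by (auto simp: order_of_closers_def dominates_def)

lemma order_of_closers_refl: "(a, a) \<in> order_of_closers c"
  by (simp add: order_of_closers_def)

lemma dominates_trans: "dominates c a b \<Longrightarrow> dominates c b d \<Longrightarrow> dominates c a d"
proof -
  assume ab: "dominates c a b" and bd: "dominates c b d"
  have "height c j < height c a" if "j \<in> {a<..d}" for j
  proof (cases "j \<le> b")
    case True
    then show ?thesis using ab that by (simp add: dominates_def)
  next
    case False
    then have "height c j < height c b" using bd that by (simp add: dominates_def)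
    also have "height c b < height c a" using ab by (simp add: dominates_def)
    finally show ?thesis .
  qed
  then show ?thesis using ab bd by (simp add: dominates_def)
qed

lemma dominates_prefix: "dominates c a d \<Longrightarrow> a < b \<Longrightarrow> b \<le> d \<Longrightarrow> dominates c a b"
  by (auto simp: dominates_def)

text \<open>A relation \<open>Inv\<close> on pairs \<open>a < b\<close> is the inversion set of a total order iff both \<open>Inv\<close> and its
  complement are transitive. For domination, transitivity of the complement follows from closure under
  prefixes. The case distinction in the proof is on the numerical order of the three elements.\<close>
lemma linear_order_of_closers: "linear_order (order_of_closers c)"
proof -
  let ?r = "order_of_closers c"
  have "trans ?r"
  proof (rule transI)
    fix x y z assume xy: "(x, y) \<in> ?r" and yz: "(y, z) \<in> ?r"
    show "(x, z) \<in> ?r"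
    proof (cases x y rule: linorder_cases)
      case xly: less
      show ?thesis
      proof (cases y z rule: linorder_cases)
        case less
        have "\<not> dominates c x z"
          using xy xly less dominates_prefix[of c x z y] order_of_closers_less by auto
        then show ?thesis using xly less order_of_closers_less(2)[of x z c] by simp
      next
        case greater
        then have zy: "dominates c z y" using yz order_of_closers_less by blast
        consider "z < x" | "z = x" | "x < z" by linarith
        then show ?thesis
        proof cases
          case 1
          then have "dominates c z x" using zy xly dominates_prefix by auto
          then show ?thesis using 1 order_of_closers_less by blast
        next
          case 2
          then show ?thesis by (simp add: order_of_closers_refl)
        next
          case 3
          then have "\<not> dominates c x z"
            using zy xy xly dominates_trans order_of_closers_less by blast
          then show ?thesis using 3 order_of_closers_less by blast
        qed
      qed (use xy in simp)
    next
      case equal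
      then show ?thesis using yz by simp
    next
      case ylx: greater
      then have yx: "dominates c y x" using xy order_of_closers_less by blast
      show ?thesis
      proof (cases y z rule: linorder_cases)
        case less
        then have yz': "\<not> dominates c y z" using yz order_of_closers_less by blast
        then have "x < z" using yx less dominates_prefix[of c y x z] by force
        moreover have "\<not> dominates c x z" using yx yz' dominates_trans by blast
        ultimately show ?thesis using order_of_closers_less by blast
      next
        case greater
        then have "dominates c z x" using yx yz dominates_trans order_of_closers_less by blast
        moreover have "z < x" using greater ylx by simp
        ultimately show ?thesis using order_of_closers_less by blast
      qed (use xy in simp)
    qed
  qed
  moreover have "antisym ?r"
    by (rule antisymI) (auto simp: order_of_closers_def dominates_def)
  moreover have "total_on UNIV ?r"
    unfolding total_on_def order_of_closers_def by auto
  moreover have "refl_on UNIV ?r" by (simp add: refl_on_def order_of_closers_refl)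
  ultimately show ?thesis
    by (simp add: linear_order_on_def partial_order_on_def preorder_on_def)
qed

lemma avoids_order_of_closers: "avoids_312 (order_of_closers c)"
  unfolding avoids_312_def
proof clarify
  fix a b d :: int
  assume "a < b" "b < d" "(d, a) \<in> order_of_closers c" "(a, b) \<in> order_of_closers c"
  then show False
    using order_of_closers_less(1)[of a d c] order_of_closers_less(2)[of a b c]
      dominates_prefix[of c a d b] by simp
qed

text \<open>The bound on the sum says that the path does not rise over a period, so every closing bracket finds a
  partner. Without it, different sequences could give the same order.\<close>
locale closer_sequence =
  fixes n :: nat and c :: "int \<Rightarrow> nat"
  assumes n_pos: "n > 0"
    and periodic: "c (j + int n) = c j"
    and sum_le: "(\<Sum>i\<in>{0..<int n}. c i) \<le> n"
begin

lemma height_shift: "height c (j + int n) = height c j + height c (int n)"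
proof (induction j rule: int_induct[of _ 0])
  case base
  show ?case by simp
next
  case (step1 i)
  then show ?case
    using height_step[of c i] height_step[of c "i + int n"] periodic[of i]
    by (simp add: algebra_simps)
next
  case (step2 i)
  then show ?case
    using height_step[of c "i - 1"] height_step[of c "i - 1 + int n"] periodic[of "i - 1"]
    by (simp add: algebra_simps)
qed

lemma height_period_le: "height c (j + int n) \<le> height c j"
proof -
  have "height c (int n) = int (\<Sum>i\<in>{0..<int n}. c i) - int n"
    using height_diff[of 0 "int n" c] by simp
  then show ?thesis using sum_le height_shift[of j] by linarith
qed

lemma dominates_shift: "dominates c (a + int n) (b + int n) \<longleftrightarrow> dominates c a b"
proof -
  have img: "{a + int n<..b + int n} = (\<lambda>j. j + int n) ` {a<..b}"
    by (auto intro: image_eqI[of _ _ "_ - int n"])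
  show ?thesis unfolding dominates_def img by (simp add: height_shift)
qed

lemma tito_order_of_closers: "tito n (order_of_closers c)"
  unfolding tito_def
  by (simp add: linear_order_of_closers) (simp add: order_of_closers_def dominates_shift)

text \<open>The elements closed at \<open>j\<close> are those at which the path was, before \<open>j + 1\<close>, for the last time at or above a level
  between its heights at \<open>j\<close> and \<open>j + 1\<close>. As the path goes down by at most \<open>1\<close> per step, each of these
  \<open>c j\<close> levels is met exactly at its last visit; and it was visited, because one period before
  \<open>j + 1\<close> the path was at least as high as at \<open>j + 1\<close>.\<close>
lemma closers_order_of_closers: "closers (order_of_closers c) j = c j"
proof -
  define A where "A = {a. a \<le> j \<and> (\<forall>i\<in>{a<..j}. height c i < height c a)
                          \<and> height c a \<le> height c (j + 1)}"
  have "closes (order_of_closers c) a j \<longleftrightarrow> a \<in> A" for a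
  proof (cases "a \<le> j")
    case True
    have "(a, j + 1) \<in> order_of_closers c \<longleftrightarrow> \<not> dominates c a (j + 1)"
      using True by (simp add: order_of_closers_less)
    moreover have "(j, a) \<in> order_of_closers c \<longleftrightarrow> (\<forall>i\<in>{a<..j}. height c i < height c a)"
    proof (cases "a = j")
      case False
      then have "a < j" using True by simp
      then show ?thesis by (simp add: order_of_closers_less dominates_def)
    qed (simp add: order_of_closers_refl)
    moreover have "{a<..j + 1} = insert (j + 1) {a<..j}" using True by auto
    ultimately show ?thesis using True by (auto simp: closes_def A_def dominates_def)
  qed (simp add: closes_def A_def)
  then have "closers (order_of_closers c) j = card A" by (simp add: closers_def)
  also have "card A = card {height c j..height c (j + 1)}"
  proof (rule bij_betw_same_card[of "height c"])
    have "inj_on (height c) A"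
    proof (rule inj_onI)
      have False if "a \<in> A" "a' \<in> A" "height c a = height c a'" "a < a'" for a a'
        using that by (auto simp: A_def)
      then show "a = a'" if "a \<in> A" "a' \<in> A" "height c a = height c a'" for a a'
        using that by (metis linorder_neqE)
    qed
    moreover have "height c ` A \<subseteq> {height c j..height c (j + 1)}"
    proof
      fix v assume "v \<in> height c ` A"
      then obtain a where a: "a \<in> A" "v = height c a" by blast
      have "height c j \<le> height c a"
      proof (cases "a = j")
        case False
        then have "j \<in> {a<..j}" using a by (simp add: A_def)
        then show ?thesis using a unfolding A_def by fastforce
      qed simp
      then show "v \<in> {height c j..height c (j + 1)}" using a by (simp add: A_def)
    qed
    moreover have "{height c j..height c (j + 1)} \<subseteq> height c ` A"
    proof
      fix v assume v: "v \<in> {height c j..height c (j + 1)}"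
      define S where "S = {a \<in> {j + 1 - int n..j}. v \<le> height c a}"
      have "v \<le> height c (j + 1 - int n)" using v height_period_le[of "j + 1 - int n"] by simp
      then have "j + 1 - int n \<in> S" using n_pos by (simp add: S_def)
      moreover have fin: "finite S"
        unfolding S_def by (rule finite_subset[of _ "{j + 1 - int n..j}"]) auto
      ultimately have S: "Max S \<in> S" using Max_in by blast
      define a where "a = Max S"
      have a: "a \<le> j" "j + 1 - int n \<le> a" "v \<le> height c a"
        using S by (auto simp: S_def a_def)
      have later: "height c i < v" if "i \<in> {a<..j}" for i
      proof (rule ccontr)
        assume "\<not> height c i < v"
        then have "i \<in> S" using that a by (simp add: S_def)
        then have "i \<le> a" using fin by (simp add: a_def)
        then show False using that by simp
      qed
      have "height c a \<le> v"
      proof (cases "a = j")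
        case False
        then have "height c (a + 1) < v" using later[of "a + 1"] a by simp
        then show ?thesis using height_step[of c a] by simp
      qed (use v in simp)
      then have "height c a = v" using a by simp
      moreover have "a \<in> A" using later v a \<open>height c a = v\<close> by (simp add: A_def)
      ultimately show "v \<in> height c ` A" by blast
    qed
    ultimately show "bij_betw (height c) A {height c j..height c (j + 1)}"
      unfolding bij_betw_def by blast
  qed
  also have "\<dots> = c j" by (simp add: height_step)
  finally show ?thesis .
qed

end

section \<open>Encoding by words\<close>
lemma periodic_mod:
  fixes f :: "int \<Rightarrow> 'a"
  assumes "\<And>j. f (j + m) = f j"
  shows "f (j mod m) = f j"
proof -
  have "f (i + k * m) = f i" for i k
  proof (induction k rule: int_induct[of _ 0])
    case (step1 k)
    then show ?case using assms[of "i + k * m"] by (simp add: algebra_simps)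
  next
    case (step2 k)
    then show ?case using assms[of "i + (k - 1) * m"] by (simp add: algebra_simps)
  qed simp
  from this[of "j mod m" "j div m"] show ?thesis by simp
qed

definition closer_word :: "nat \<Rightarrow> int rel \<Rightarrow> nat list" where
  "closer_word n r = map (\<lambda>i. closers r (int i)) [0..<n]"

lemma sum_list_map_int:
  fixes f :: "int \<Rightarrow> nat"
  shows "sum_list (map (\<lambda>i. f (int i)) [0..<n]) = (\<Sum>i\<in>{0..<int n}. f i)"
proof -
  have "(\<Sum>i\<in>{0..<int n}. f i) = (\<Sum>i\<in>int ` {0..<n}. f i)"
    by (simp add: image_int_atLeastLessThan)
  also have "\<dots> = (\<Sum>i\<in>{0..<n}. f (int i))" by (simp add: sum.reindex)
  finally show ?thesis by (simp add: interv_sum_list_conv_sum_set_nat)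
qed

lemma (in tamari_order) sum_list_closer_word: "sum_list (closer_word n r) + waning_count = n"
  unfolding closer_word_def sum_list_map_int by (rule sum_closers_waning_count)

lemma tamari_order_iff: "n > 0 \<Longrightarrow> tamari_order n r \<longleftrightarrow> r \<in> CTam n"
  by (auto simp: tamari_order_def CTam_def)

lemma inj_closer_word:
  assumes "n > 0" shows "inj_on (closer_word n) (CTam n)"
proof (rule inj_onI)
  fix r s assume "r \<in> CTam n" "s \<in> CTam n" and eq: "closer_word n r = closer_word n s"
  then interpret r: tamari_order n r + s: tamari_order n s
    using tamari_order_iff[OF assms] by auto
  have "closers r j = closers s j" for j
  proof -
    have "closers r (int i) = closers s (int i)" if "i < n" for i
      using eq that unfolding closer_word_def by (metis (lifting) add_0 diff_zero length_upt nth_map nth_upt)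
    from this[of "nat (j mod int n)"] have "closers r (j mod int n) = closers s (j mod int n)"
      using assms by (simp add: nat_less_iff)
    then show ?thesis
      using periodic_mod[of "closers r", OF r.closers_periodic]
        periodic_mod[of "closers s", OF s.closers_periodic] by simp
  qed
  then have "closers r = closers s" by blast
  then show "r = s" using r.order_of_closers_closers s.order_of_closers_closers by metis
qed

lemma closer_word_surj:
  assumes "n > 0" "length l = n" "sum_list l \<le> n"
  shows "\<exists>r\<in>CTam n. closer_word n r = l"
proof -
  define c where "c = (\<lambda>j. l ! nat (j mod int n))"
  have word: "map (\<lambda>i. c (int i)) [0..<n] = l"
    using assms by (intro nth_equalityI) (auto simp: c_def)
  interpret closer_sequence n c
  proof
    show "(\<Sum>i\<in>{0..<int n}. c i) \<le> n"
      unfolding sum_list_map_int[symmetric] word by (rule assms)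
  qed (use assms in \<open>simp_all add: c_def\<close>)
  have "order_of_closers c \<in> CTam n"
    by (simp add: CTam_def tito_order_of_closers avoids_order_of_closers)
  moreover have "closer_word n (order_of_closers c) = l"
    unfolding closer_word_def closers_order_of_closers by (rule word)
  ultimately show ?thesis by blast
qed

lemma bij_closer_word:
  assumes "n > 0"
  shows "bij_betw (closer_word n) (CTam n) {l. length l = n \<and> sum_list l \<le> n}"
  unfolding bij_betw_def
proof (intro conjI equalityI subsetI inj_closer_word assms)
  fix l assume "l \<in> closer_word n ` CTam n"
  then obtain r where r: "r \<in> CTam n" "l = closer_word n r" by blast
  then interpret tamari_order n r using tamari_order_iff[OF assms] by auto
  show "l \<in> {l. length l = n \<and> sum_list l \<le> n}"
    using sum_list_closer_word r by (simp add: closer_word_def)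
qed (use closer_word_surj[OF assms] in force)

text \<open>Prepending the slack \<open>s - sum_list l\<close> turns the bound into an equality.\<close>
lemma card_sum_list_le:
  "card {l :: nat list. length l = m \<and> sum_list l \<le> s} = (s + m) choose s"
proof -
  have "bij_betw (\<lambda>l. (s - sum_list l) # l) {l. length l = m \<and> sum_list l \<le> s}
          {l :: nat list. length l = Suc m \<and> sum_list l = s}"
    by (rule bij_betw_byWitness[of _ tl]) (auto simp: length_Suc_conv)
  then show ?thesis using card_length_sum_list[of "Suc m" s] bij_betw_same_card by fastforce
qed

text \<open>The closer words are the weak compositions of numbers up to \<open>n\<close> into \<open>n\<close> parts.\<close>
lemma card_CTam: "n > 0 \<Longrightarrow> card (CTam n) = (2 * n) choose n"
  using bij_betw_same_card[OF bij_closer_word] card_sum_list_le[of n n] by (simp add: mult_2)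

text \<open>Exactly one waning residue means that the closing brackets number \<open>n - 1\<close> per period.\<close>
lemma card_CTam_diff_ATam:
  assumes "n > 0"
  shows "card (CTam n - ATam n) = (2 * n - 2) choose (n - 1)"
proof -
  have "r \<notin> ATam n \<longleftrightarrow> sum_list (closer_word n r) = n - 1" if "r \<in> CTam n" for r
  proof -
    interpret tamari_order n r using tamari_order_iff[OF assms] that by simp
    have "r \<notin> ATam n \<longleftrightarrow> waning_count = 1"
      using real_iff_waning_count avoids by (simp add: ATam_def)
    then show ?thesis using sum_list_closer_word assms by linarith
  qed
  then have diff: "CTam n - ATam n = {r \<in> CTam n. sum_list (closer_word n r) = n - 1}" by blast
  have words: "closer_word n ` CTam n = {l. length l = n \<and> sum_list l \<le> n}"
    using bij_closer_word[OF assms] by (simp add: bij_betw_def)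
  have "closer_word n ` (CTam n - ATam n) = {l. length l = n \<and> sum_list l = n - 1}"
  proof -
    have "closer_word n ` (CTam n - ATam n)
          = {l \<in> closer_word n ` CTam n. sum_list l = n - 1}" unfolding diff by blast
    then show ?thesis unfolding words by auto
  qed
  moreover have "inj_on (closer_word n) (CTam n - ATam n)"
    using inj_closer_word[OF assms] by (rule inj_on_subset) blast
  ultimately have "card (CTam n - ATam n) = card {l. length l = n \<and> sum_list l = n - 1}"
    using card_image by metis
  then show ?thesis
    using card_length_sum_list[of n "n - 1"] assms by (simp add: mult_2 numeral_2_eq_2)
qed

lemma card_ATam:
  assumes "n > 0"
  shows "card (ATam n) + ((2 * n - 2) choose (n - 1)) = (2 * n) choose n"
proof -
  have sub: "ATam n \<subseteq> CTam n" by (auto simp: ATam_def CTam_def real_tito_def)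
  have "card (CTam n) > 0" using card_CTam[OF assms] by simp
  then have fin: "finite (CTam n)" by (rule card_ge_0_finite)
  have "card (CTam n - ATam n) = card (CTam n) - card (ATam n)"
    using sub fin by (simp add: card_Diff_subset finite_subset)
  moreover have "card (ATam n) \<le> card (CTam n)" using sub fin by (rule card_mono[rotated])
  ultimately show ?thesis
    using card_CTam[OF assms] card_CTam_diff_ATam[OF assms] by simp
qed

section \<open>Coxeter--Catalan numbers\<close>
lemma coxeter_catalan_even_degrees:
  "coxeter_catalan (2 * p) (map (\<lambda>i. 2 * i) [1..<m + 1]) = real ((p + m) choose m)"
proof (induction m)
  case (Suc m)
  have "real (Suc m) * real ((p + Suc m) choose Suc m)
        = real (p + Suc m) * real ((p + m) choose m)"
    using binomial_absorption[of m "p + Suc m"] by (metis Suc_eq_plus1 add_Suc_right diff_Suc_1 of_nat_mult)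
  moreover have "coxeter_catalan (2 * p) (map (\<lambda>i. 2 * i) [1..<Suc m + 1])
        = coxeter_catalan (2 * p) (map (\<lambda>i. 2 * i) [1..<m + 1]) * (real (2 * p + 2 * Suc m) / real (2 * Suc m))"
    by (simp add: coxeter_catalan_def)
  moreover have "real (2 * p + 2 * Suc m) / real (2 * Suc m) = real (p + Suc m) / real (Suc m)"
    by (simp add: field_simps)
  moreover have "real ((p + Suc m) choose Suc m)
        = real ((p + m) choose m) * (real (p + Suc m) / real (Suc m))"
    using calculation(1) by (simp add: eq_divide_eq mult.commute)
  ultimately show ?case using Suc by metis
qed (simp add: coxeter_catalan_def)

text \<open>Subtracting one copy of the smaller binomial from the right-hand side lowers the factor
  \<open>4n - 2\<close> to \<open>3n - 2\<close>, which is how type \<open>B\<close> becomes type \<open>D\<close>.\<close>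
lemma central_binomial_rec:
  assumes "n > 0"
  shows "real ((2 * n) choose n) = (4 * real n - 2) / real n * real ((2 * n - 2) choose (n - 1))"
proof -
  obtain m where n: "n = Suc m" using assms by (metis gr0_implies_Suc)
  have "Suc m * ((2 * n) choose n) = 2 * n * (Suc (2 * m) choose m)"
    using binomial_absorption[of m "2 * n"] n by simp
  also have "\<dots> = Suc m * (2 * (Suc (2 * m) choose m))" using n by simp
  finally have "(2 * n) choose n = 2 * (Suc (2 * m) choose m)"
    by (metis mult_left_cancel nat.distinct(1))
  moreover have "Suc m * (Suc (2 * m) choose m) = Suc (2 * m) * ((2 * m) choose m)"
    using binomial_absorb_comp[of "Suc (2 * m)" m] by (simp add: Suc_diff_le)
  ultimately have "Suc m * ((2 * n) choose n) = 2 * (Suc (2 * m) * ((2 * m) choose m))"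
    by (metis mult.left_commute)
  then have "real (Suc m) * real ((2 * n) choose n)
             = 2 * (real (Suc (2 * m)) * real ((2 * m) choose m))"
    by (metis of_nat_mult of_nat_numeral)
  then show ?thesis using n by (simp add: field_simps)
qed

theorem corollary5p2:
  fixes n :: nat
  assumes "n \<ge> 2"
  shows "real (card (CTam n)) = Cat_B n \<and>
         Cat_B n = real ((2 * n) choose n) \<and>
         real (card (ATam n)) = Cat_D n \<and>
         Cat_D n = (3 * real n - 2) / real n * real ((2 * n - 2) choose (n - 1))"
proof -
  have pos: "n > 0" using assms by simp
  have B: "Cat_B n = real ((2 * n) choose n)"
    using coxeter_catalan_even_degrees[of n n] by (simp add: Cat_B_def mult_2)
  have "Cat_D n = coxeter_catalan (2 * (n - 1)) (map (\<lambda>i. 2 * i) [1..<(n - 1) + 1])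
                  * (real (2 * n - 2 + n) / real n)"
    using assms by (simp add: Cat_D_def coxeter_catalan_def right_diff_distrib')
  also have "\<dots> = real ((2 * n - 2) choose (n - 1)) * (real (2 * n - 2 + n) / real n)"
  proof -
    have "n - 1 + (n - 1) = 2 * n - 2" by simp
    then show ?thesis unfolding coxeter_catalan_even_degrees by metis
  qed
  finally have D: "Cat_D n = (3 * real n - 2) / real n * real ((2 * n - 2) choose (n - 1))"
    using assms by (simp add: of_nat_diff)
  have "real (card (ATam n)) = real ((2 * n) choose n) - real ((2 * n - 2) choose (n - 1))"
    using card_ATam[OF pos] by (metis add_diff_cancel_right' of_nat_add)
  also have "\<dots> = Cat_D n"
    unfolding D central_binomial_rec[OF pos] using pos by (simp add: field_simps)
  finally show ?thesis using B D card_CTam[OF pos] by simp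
qed

end
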